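(* Consider the following Hypothesis $H$: for every separable centered random field $\theta=\theta(t)$, $t\in T$, with $\sup_{t\in T}|\theta(t)|<\infty$ almost surely (or even, when $T$ is a compact metric space, with almost surely continuous sample paths), every Young function $\Phi$ with $\sup_{t\in T}\|\theta(t)\|_{Or(\Phi)}<\infty$, and every Young function $\Psi$ with $\lim_{u\to\infty}\Psi(u)=\infty$ and $\Psi\ll\Phi$, one has $\bigl\|\sup_{t\in T}|\theta(t)|\bigr\|_{Or(\Psi)}<\infty$. Hypothesis $H$ is false. Indeed, in each of the two cases ${\bf P}(\Omega)=1$ and ${\bf P}(\Omega)=\infty$, there exist a probabilistic space $(\Omega,\mathcal{B},{\bf P})$ of that total mass, a compact metric space $(T,d)$ with non-trivial distance $d$, a random process $\theta=\theta(t)=\theta(t,\omega)$, $t\in T$, $\omega\in\Omega$, and Young functions $\Phi$ and $\Psi$ such that: (A) $\theta$ is centered, $\theta$ is continuous on $(T,d)$ in the $Or(\Phi)$ sense and with probability one, and $$\sup_{t\in T}\|\theta(t)\|_{Or(\Phi)}<\infty;$$ (B) $\lim_{u\to\infty}\Psi(u)=\infty$ and $\Psi\ll\Phi$; (C) nevertheless $$\Bigl\|\,\sup_{t\in T}|\theta(t)|\,\Bigr\|_{Or(\Psi)}=\infty.$$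
   Context: A probabilistic space is a triplet $(\Omega,\mathcal{B},{\bf P})$ where $\Omega$ is a set, $\mathcal{B}$ is a non-trivial sigma-algebra of subsets of $\Omega$, and ${\bf P}$ is a non-zero non-negative completely (countably) additive measure on $\mathcal{B}$; this name is used even when ${\bf P}(\Omega)=\infty$. A random variable is a measurable function $\xi:\Omega\to\mathbb{R}$, and ${\bf E}\xi=\int_\Omega\xi(\omega)\,{\bf P}(d\omega)$. "Almost surely" and "with probability one" mean: outside a set of ${\bf P}$-measure zero. A random process (field) $\theta$ on $T$ is a family of random variables $\theta(t)=\theta(t,\cdot)$, $t\in T$; it is centered if ${\bf E}\theta(t)=0$ for all $t\in T$. A Young (Young-Orlicz) function is an even convex continuous function $\Phi:\mathbb{R}\to[0,\infty)$, strictly increasing on $[0,\infty)$, with $\Phi(0)=0$ and $\lim_{u\to\infty}\Phi(u)=\infty$. The Luxemburg norm of a random variable $\xi$ is $$\|\xi\|_{Or(\Phi)}=\inf\Bigl\{k>0:\ \int_\Omega\Phi(|\xi(\omega)|/k)\,{\bf P}(d\omega)\le 1\Bigr\},$$ with $\inf\emptyset=\infty$. For Young functions $\Psi,\Phi$, the notation $\Psi\ll\Phi$ means: for every $\lambda>0$, $\lim_{u\to\infty}\Psi(\lambda u)/\Phi(u)=0$. The process $\theta$ is continuous in the $Or(\Phi)$ sense if for every $t\in T$, $\|\theta(s)-\theta(t)\|_{Or(\Phi)}\to0$ as $d(s,t)\to0$; it is continuous with probability one if for almost every $\omega$ the function $t\mapsto\theta(t,\omega)$ is continuous on $(T,d)$.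 A distance $d$ on $T$ is called non-trivial here if it is not the discrete $0$–$1$ distance. *)

theory Defs
  imports "HOL-Probability.Probability"
begin

(* Total mass is not normalised and may be infinite.  A non-trivial sigma-algebra is one
   containing a set other than the empty set and the whole space. *)
definition probabilistic_space :: "'w measure \<Rightarrow> bool" where
  "probabilistic_space M \<longleftrightarrow>
     (\<exists>A\<in>sets M. A \<noteq> {} \<and> A \<noteq> space M) \<and> emeasure M (space M) \<noteq> 0"

definition young_function :: "(real \<Rightarrow> real) \<Rightarrow> bool" where
  "young_function \<Phi> \<longleftrightarrow>
     (\<forall>u. 0 \<le> \<Phi> u) \<and> (\<forall>u. \<Phi> (- u) = \<Phi> u) \<and> convex_on UNIV \<Phi> \<and>
     continuous_on UNIV \<Phi> \<and> strict_mono_on {0..} \<Phi> \<and> \<Phi> 0 = 0 \<and> filterlim \<Phi> at_top at_top"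

(* The infimum is taken in ennreal, so the infimum of the empty set is infinity. *)
definition luxemburg_norm :: "'w measure \<Rightarrow> (real \<Rightarrow> real) \<Rightarrow> ('w \<Rightarrow> real) \<Rightarrow> ennreal" where
  "luxemburg_norm M \<Phi> \<xi> =
     (INF k\<in>{k::real. 0 < k \<and> (\<integral>\<^sup>+\<omega>. ennreal (\<Phi> (\<bar>\<xi> \<omega>\<bar> / k)) \<partial>M) \<le> 1}. ennreal k)"

definition essentially_weaker :: "(real \<Rightarrow> real) \<Rightarrow> (real \<Rightarrow> real) \<Rightarrow> bool" (infix "\<lless>" 50) where
  "\<Psi> \<lless> \<Phi> \<longleftrightarrow> (\<forall>c>0. ((\<lambda>u. \<Psi> (c * u) / \<Phi> u) \<longlongrightarrow> 0) at_top)"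

definition random_process :: "'w measure \<Rightarrow> 't set \<Rightarrow> ('t \<Rightarrow> 'w \<Rightarrow> real) \<Rightarrow> bool" where
  "random_process M T \<theta> \<longleftrightarrow> (\<forall>t\<in>T. \<theta> t \<in> borel_measurable M)"

(* Integrability is explicit because the Bochner integral of a non-integrable function is 0. *)
definition centered :: "'w measure \<Rightarrow> 't set \<Rightarrow> ('t \<Rightarrow> 'w \<Rightarrow> real) \<Rightarrow> bool" where
  "centered M T \<theta> \<longleftrightarrow> (\<forall>t\<in>T. integrable M (\<theta> t) \<and> (\<integral>\<omega>. \<theta> t \<omega> \<partial>M) = 0)"

(* Separability in the sense of Doob: one null set and one countable separant S serve all
   points t; since the closure of the empty set is empty, S is dense in T. *)
definition separable_process ::
    "'w measure \<Rightarrow> 't set \<Rightarrow> ('t \<Rightarrow> 't \<Rightarrow> real) \<Rightarrow> ('t \<Rightarrow> 'w \<Rightarrow> real) \<Rightarrow> bool" where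
  "separable_process M T d \<theta> \<longleftrightarrow>
     (\<exists>S\<subseteq>T. countable S \<and>
        (AE \<omega> in M. \<forall>G. openin (Metric_space.mtopology T d) G \<longrightarrow>
            (\<forall>t\<in>G. \<theta> t \<omega> \<in> closure ((\<lambda>s. \<theta> s \<omega>) ` (S \<inter> G)))))"

definition bounded_paths :: "'w measure \<Rightarrow> 't set \<Rightarrow> ('t \<Rightarrow> 'w \<Rightarrow> real) \<Rightarrow> bool" where
  "bounded_paths M T \<theta> \<longleftrightarrow> (AE \<omega> in M. bdd_above ((\<lambda>t. \<bar>\<theta> t \<omega>\<bar>) ` T))"

definition continuous_paths ::
    "'w measure \<Rightarrow> 't set \<Rightarrow> ('t \<Rightarrow> 't \<Rightarrow> real) \<Rightarrow> ('t \<Rightarrow> 'w \<Rightarrow> real) \<Rightarrow> bool" where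
  "continuous_paths M T d \<theta> \<longleftrightarrow>
     (AE \<omega> in M. continuous_map (Metric_space.mtopology T d) euclideanreal (\<lambda>t. \<theta> t \<omega>))"

definition orlicz_continuous ::
    "'w measure \<Rightarrow> (real \<Rightarrow> real) \<Rightarrow> 't set \<Rightarrow> ('t \<Rightarrow> 't \<Rightarrow> real) \<Rightarrow> ('t \<Rightarrow> 'w \<Rightarrow> real) \<Rightarrow> bool" where
  "orlicz_continuous M \<Phi> T d \<theta> \<longleftrightarrow>
     (\<forall>t\<in>T. ((\<lambda>s. luxemburg_norm M \<Phi> (\<lambda>\<omega>. \<theta> s \<omega> - \<theta> t \<omega>)) \<longlongrightarrow> 0)
                (atin (Metric_space.mtopology T d) t))"

(* The real supremum is used only for non-empty T and processes with almost surely bounded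
   paths.  On the exceptional null set its value is unspecified, which affects neither
   the integral nor the Luxemburg norm. *)
definition sup_abs :: "'t set \<Rightarrow> ('t \<Rightarrow> 'w \<Rightarrow> real) \<Rightarrow> 'w \<Rightarrow> real" where
  "sup_abs T \<theta> \<omega> = (SUP t\<in>T. \<bar>\<theta> t \<omega>\<bar>)"

definition compact_metric_space :: "'t set \<Rightarrow> ('t \<Rightarrow> 't \<Rightarrow> real) \<Rightarrow> bool" where
  "compact_metric_space T d \<longleftrightarrow>
     Metric_space T d \<and> compact_space (Metric_space.mtopology T d)"

definition nontrivial_distance :: "'t set \<Rightarrow> ('t \<Rightarrow> 't \<Rightarrow> real) \<Rightarrow> bool" where
  "nontrivial_distance T d \<longleftrightarrow> (\<exists>s\<in>T. \<exists>t\<in>T. d s t \<noteq> (if s = t then 0 else 1))"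

(* Hypothesis H, in its form for bounded fields.  The type arguments fix the types of sample
   points and of parameters; refuting one instance refutes H over arbitrary spaces. *)
definition hypothesis_H_bounded :: "'w itself \<Rightarrow> 't itself \<Rightarrow> bool" where
  "hypothesis_H_bounded _ _ \<longleftrightarrow>
     (\<forall>(M::'w measure) (T::'t set) d \<theta> \<Phi> \<Psi>.
        probabilistic_space M \<and> T \<noteq> {} \<and> Metric_space T d \<and>
        random_process M T \<theta> \<and> separable_process M T d \<theta> \<and> centered M T \<theta> \<and>
        bounded_paths M T \<theta> \<and>
        young_function \<Phi> \<and> (SUP t\<in>T. luxemburg_norm M \<Phi> (\<theta> t)) < \<infinity> \<and>
        young_function \<Psi> \<and> filterlim \<Psi> at_top at_top \<and> \<Psi> \<lless> \<Phi>
        \<longrightarrow> luxemburg_norm M \<Psi> (sup_abs T \<theta>) < \<infinity>)"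

(* The weaker form of H, for almost surely continuous fields on compact metric spaces. *)
definition hypothesis_H_continuous :: "'w itself \<Rightarrow> 't itself \<Rightarrow> bool" where
  "hypothesis_H_continuous _ _ \<longleftrightarrow>
     (\<forall>(M::'w measure) (T::'t set) d \<theta> \<Phi> \<Psi>.
        probabilistic_space M \<and> T \<noteq> {} \<and> compact_metric_space T d \<and>
        random_process M T \<theta> \<and> separable_process M T d \<theta> \<and> centered M T \<theta> \<and>
        continuous_paths M T d \<theta> \<and>
        young_function \<Phi> \<and> (SUP t\<in>T. luxemburg_norm M \<Phi> (\<theta> t)) < \<infinity> \<and>
        young_function \<Psi> \<and> filterlim \<Psi> at_top at_top \<and> \<Psi> \<lless> \<Phi>
        \<longrightarrow> luxemburg_norm M \<Psi> (sup_abs T \<theta>) < \<infinity>)"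

end

theory Submission imports Defs "HOL-Real_Asymp.Real_Asymp" begin

text \<open>
  Cut the odd function 1/\<omega> on \<open>[-1/2, 1/2]\<close> into its pieces on the sets where \<open>1/(2 \<omega>)\<^sup>2\<close>
  has integer part n.  The n-th piece is bounded by \<open>2 sqrt (n + 1)\<close> on a set of Lebesgue measure
  \<open>1/sqrt n - 1/sqrt (n + 1)\<close>, so its \<open>L\<^sup>2\<close> norm tends to 0; the supremum of all pieces is
  1/|\<omega>|, which is not in \<open>L\<^sup>1\<close>.  The n-th piece is put at the parameter 1/n of the convergent sequence
  \<open>{0} \<union> {1/n}\<close>, with 0 at the limit.  Each \<omega> lies in at most one piece, so every path is
  continuous.  As the pieces vanish outside \<open>[-1/2, 1/2]\<close>, the same process works
  for total mass 1 and for Lebesgue measure on the whole line.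
\<close>

section \<open>Parameter set, process and topology\<close>

definition harmonic_points :: "real set" where
  "harmonic_points = insert 0 (range (\<lambda>n. 1 / real (Suc n)))"

text \<open>Membership in the piece of index \<open>1 / t\<close> is tested by a product, so
  \<open>t = 0\<close> gives the zero function with no case distinction. At
  \<open>\<omega> = 0\<close> the convention \<open>1 / 0 = 0\<close> makes the integer part 0, so
  the value is 0 there as well.\<close>

definition pieces :: "real \<Rightarrow> real \<Rightarrow> real" where
  "pieces t \<omega> = (if t * \<lfloor>1 / (2 * \<omega>)\<^sup>2\<rfloor> = 1 then 1 / \<omega> else 0)"

lemma harmonic_tendsto: "(\<lambda>n. 1 / real (Suc n)) \<longlonglongrightarrow> 0"
  by real_asymp

lemma Metric_space_dist: "Metric_space T dist"
  by (rule Met_TC.subspace) simp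

lemma mtopology_dist: "Metric_space.mtopology T dist = top_of_set T"
proof -
  interpret Submetric UNIV dist T
    by unfold_locales simp
  show ?thesis
    using mtopology_submetric by simp
qed

lemma atin_within_euclidean: "atin_within euclidean a S = at a within S"
  by (auto simp: filter_eq_iff eventually_atin_within eventually_at_topological)

lemma compact_harmonic_points: "compact harmonic_points"
  unfolding harmonic_points_def by (rule compact_sequence_with_limit[OF harmonic_tendsto])

text \<open>A convergent sequence has no limit point besides its limit, so every nonzero point is
  isolated and its punctured filter is trivial. Near 0, closeness forces a large index, so
  convergence along \<open>1 / real (Suc n)\<close> is enough.\<close>

lemma tendsto_within_harmonic_points:
  fixes g :: "real \<Rightarrow> 'a::topological_space"
  assumes "t \<in> harmonic_points"
    and lim: "t = 0 \<Longrightarrow> (\<lambda>n. g (1 / real (Suc n))) \<longlonglongrightarrow> l"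
  shows "(g \<longlongrightarrow> l) (at t within harmonic_points)"
proof (cases "t = 0")
  case False
  then have "\<not> t islimpt harmonic_points"
    unfolding harmonic_points_def islimpt_insert
    using sequence_unique_limpt[OF harmonic_tendsto] by blast
  then have "at t within harmonic_points = bot"
    using trivial_limit_within by blast
  then show ?thesis
    by simp
next
  case True
  show ?thesis
  proof (rule topological_tendstoI)
    fix U :: "'a set" assume "open U" "l \<in> U"
    then obtain N where N: "g (1 / real (Suc n)) \<in> U" if "n \<ge> N" for n
      using topological_tendstoD[OF lim[OF True]] by (auto simp: eventually_sequentially)
    have "g s \<in> U" if "s \<in> harmonic_points" "s \<noteq> 0" "dist s 0 < 1 / real (Suc N)" for s
    proof -
      obtain n where n: "s = 1 / real (Suc n)"
        using \<open>s \<in> harmonic_points\<close> \<open>s \<noteq> 0\<close> by (auto simp: harmonic_points_def)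
      with that have "1 / real (Suc n) < 1 / real (Suc N)" by simp
      then have "n \<ge> N" by (simp add: field_simps)
      then show ?thesis using N n by simp
    qed
    then show "\<forall>\<^sub>F s in at t within harmonic_points. g s \<in> U"
      unfolding eventually_at True by (intro exI[of _ "1 / real (Suc N)"]) auto
  qed
qed

section \<open>Size and support of the pieces\<close>

lemma pieces_zero [simp]: "pieces 0 = (\<lambda>_. 0)"
  by (simp add: pieces_def fun_eq_iff)

lemma pieces_minus [simp]: "pieces t (- \<omega>) = - pieces t \<omega>"
  by (simp add: pieces_def)

lemma pieces_measurable [measurable]: "pieces t \<in> borel_measurable borel"
  unfolding pieces_def by measurable

lemma abs_pieces_le: "\<bar>pieces t \<omega>\<bar> \<le> 1 / \<bar>\<omega>\<bar>"
  by (simp add: pieces_def)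

text \<open>A nonzero value fixes the integer part as \<open>n + 1\<close>, which confines
  \<open>1 / (2 * \<omega>)\<^sup>2\<close> to the interval from \<open>n + 1\<close> to
  \<open>n + 2\<close>; the bounds follow by solving for \<open>\<bar>\<omega>\<bar>\<close>.
  Closing the interval adds only a null set.\<close>

lemma pieces_support:
  assumes "pieces (1 / real (Suc n)) \<omega> \<noteq> 0"
  shows "1 / (2 * sqrt (real n + 2)) \<le> \<bar>\<omega>\<bar>" and "\<bar>\<omega>\<bar> \<le> 1 / (2 * sqrt (real n + 1))"
proof -
  have [simp]: "\<omega> \<noteq> 0" and "\<lfloor>1 / (2 * \<omega>)\<^sup>2\<rfloor> = int n + 1"
    using assms by (auto simp: pieces_def field_simps split: if_splits)
  then have "real n + 1 \<le> 1 / (2 * \<omega>)\<^sup>2" "1 / (2 * \<omega>)\<^sup>2 \<le> real n + 2"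
    by linarith+
  then have *: "(real n + 1) * (2 * \<bar>\<omega>\<bar>)\<^sup>2 \<le> 1" "1 \<le> (real n + 2) * (2 * \<bar>\<omega>\<bar>)\<^sup>2"
    by (simp_all add: divide_simps power_mult_distrib)
  have "sqrt (real n + 1) * (2 * \<bar>\<omega>\<bar>) \<le> 1"
    by (rule power2_le_imp_le) (use * in \<open>simp_all add: power_mult_distrib\<close>)
  then show "\<bar>\<omega>\<bar> \<le> 1 / (2 * sqrt (real n + 1))"
    by (simp add: field_simps)
  have "1 \<le> sqrt (real n + 2) * (2 * \<bar>\<omega>\<bar>)"
    by (rule power2_le_imp_le) (use * in \<open>simp_all add: power_mult_distrib\<close>)
  then show "1 / (2 * sqrt (real n + 2)) \<le> \<bar>\<omega>\<bar>"
    by (simp add: field_simps)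
qed

lemma abs_pieces_le_sqrt:
  "\<bar>pieces (1 / real (Suc n)) \<omega>\<bar> \<le> 2 * sqrt (real n + 2)"
proof (cases "pieces (1 / real (Suc n)) \<omega> = 0")
  case False
  have a: "1 / (2 * sqrt (real n + 2)) \<le> \<bar>\<omega>\<bar>"
    using pieces_support(1)[OF False] .
  moreover have "0 < 1 / (2 * sqrt (real n + 2))" by simp
  ultimately have "0 < \<bar>\<omega>\<bar>" by linarith
  with a have "1 / \<bar>\<omega>\<bar> \<le> 2 * sqrt (real n + 2)"
    by (simp add: field_simps)
  then show ?thesis using abs_pieces_le order_trans by blast
qed simp

text \<open>The outer end of the support is largest for \<open>n = 0\<close>, where it equals
  1/2.\<close>

lemma pieces_outside:
  assumes "t \<in> harmonic_points" "\<omega> \<notin> {-1/2..1/2}"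
  shows "pieces t \<omega> = 0"
proof (rule ccontr)
  assume nz: "pieces t \<omega> \<noteq> 0"
  then obtain n where "t = 1 / real (Suc n)"
    using assms(1) by (auto simp: harmonic_points_def)
  with nz have "\<bar>\<omega>\<bar> \<le> 1 / (2 * sqrt (real n + 1))"
    using pieces_support(2) by blast
  also have "\<dots> \<le> 1 / 2" by (simp add: field_simps)
  finally show False using assms(2) by auto
qed

section \<open>Path continuity and the supremum of the pieces\<close>

lemma continuous_on_pieces: "continuous_on harmonic_points (\<lambda>t. pieces t \<omega>)"
  unfolding continuous_on_def
proof
  fix t assume "t \<in> harmonic_points"
  then show "((\<lambda>t. pieces t \<omega>) \<longlongrightarrow> pieces t \<omega>) (at t within harmonic_points)"
  proof (rule tendsto_within_harmonic_points)
    assume "t = 0"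
    \<comment> \<open>From this index on, \<open>Suc n\<close> exceeds the integer part, so \<omega>
      lies in no further piece.\<close>
    have "pieces (1 / real (Suc n)) \<omega> = 0" if "n \<ge> nat \<lfloor>1 / (2 * \<omega>)\<^sup>2\<rfloor>" for n
    proof -
      have "real_of_int \<lfloor>1 / (2 * \<omega>)\<^sup>2\<rfloor> \<noteq> real (Suc n)" using that by linarith
      then show ?thesis by (simp add: pieces_def field_simps)
    qed
    then have "\<forall>\<^sub>F n in sequentially. pieces (1 / real (Suc n)) \<omega> = 0"
      unfolding eventually_sequentially by blast
    then show "(\<lambda>n. pieces (1 / real (Suc n)) \<omega>) \<longlonglongrightarrow> pieces t \<omega>"
      using \<open>t = 0\<close> by (simp add: tendsto_eventually)
  qed
qed

lemma bdd_above_pieces: "bdd_above ((\<lambda>t. \<bar>pieces t \<omega>\<bar>) ` T)"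
  using abs_pieces_le by (intro bdd_aboveI2) blast

text \<open>On this range \<open>1 / (2 * \<omega>)\<^sup>2\<close> is at least 1, so its integer
  part is the index of a piece containing \<omega>. The positive half of the window suffices to make
  the integral diverge.\<close>

lemma sup_abs_pieces_ge:
  assumes "\<omega> \<in> {0<..1/2}"
  shows "1 / \<omega> \<le> sup_abs harmonic_points pieces \<omega>"
proof -
  \<comment> \<open>The shift by one matches the numbering by \<open>Suc n\<close>; the truncated
    subtraction is exact because the integer part is at least 1.\<close>
  define n where "n = nat \<lfloor>1 / (2 * \<omega>)\<^sup>2\<rfloor> - 1"
  have "(2 * \<omega>)\<^sup>2 \<le> 1" using power_mono[of "2 * \<omega>" 1 2] assms by simp
  then have "1 \<le> 1 / (2 * \<omega>)\<^sup>2" using assms by (simp add: field_simps)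
  then have "1 \<le> \<lfloor>1 / (2 * \<omega>)\<^sup>2\<rfloor>" by simp
  then have "real_of_int \<lfloor>1 / (2 * \<omega>)\<^sup>2\<rfloor> = real (Suc n)" unfolding n_def by linarith
  then have "\<bar>pieces (1 / real (Suc n)) \<omega>\<bar> = 1 / \<omega>"
    using assms by (simp add: pieces_def)
  moreover have "1 / real (Suc n) \<in> harmonic_points" by (simp add: harmonic_points_def)
  ultimately show ?thesis
    unfolding sup_abs_def using cSUP_upper[OF _ bdd_above_pieces] by metis
qed

lemma nn_integral_inverse_at_0:
  "(\<integral>\<^sup>+\<omega>. ennreal (1 / \<omega>) * indicator {0<..1/2} \<omega> \<partial>lborel) = \<infinity>"
proof -
  have "ennreal (real K) \<le> (\<integral>\<^sup>+\<omega>. ennreal (1 / \<omega>) * indicator {0<..1/2} \<omega> \<partial>lborel)" for K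
  proof -
    \<comment> \<open>Cutting off here makes the integral of \<open>1 / \<omega>\<close> up to 1/2
      equal to exactly K.\<close>
    let ?a = "exp (- real K) / 2"
    have "(\<integral>\<^sup>+\<omega>. ennreal (1 / \<omega>) * indicator {?a..1/2} \<omega> \<partial>lborel) = ennreal (ln (1/2) - ln ?a)"
    proof (rule nn_integral_FTC_Icc)
      fix x :: real assume "x \<in> {?a..1/2}"
      moreover have "0 < ?a" by simp
      ultimately have "0 < x" unfolding atLeastAtMost_iff by linarith
      then show "(ln has_real_derivative 1 / x) (at x)"
        by (auto intro!: derivative_eq_intros)
      show "0 \<le> 1 / x" using \<open>0 < x\<close> by simp
    qed auto
    also have "ln (1/2) - ln ?a = real K" by (simp add: ln_div)
    finally have "ennreal (real K) = (\<integral>\<^sup>+\<omega>. ennreal (1 / \<omega>) * indicator {?a..1/2} \<omega> \<partial>lborel)" ..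
    also have "\<dots> \<le> (\<integral>\<^sup>+\<omega>. ennreal (1 / \<omega>) * indicator {0<..1/2} \<omega> \<partial>lborel)"
    proof (rule nn_integral_mono)
      fix x :: real
      have "0 < ?a" by simp
      then show "ennreal (1 / x) * indicator {?a..1/2} x \<le> ennreal (1 / x) * indicator {0<..1/2} x"
        by (auto split: split_indicator simp del: exp_gt_zero)
    qed
    finally show ?thesis .
  qed
  then show ?thesis
    by (metis ennreal_of_nat_eq_real_of_nat ennreal_Ex_less_of_nat infinity_ennreal_def linorder_not_less top.not_eq_extremum)
qed

section \<open>The two Young functions and upper bounds for Luxemburg norms\<close>

lemma young_function_power2: "young_function power2"
  unfolding young_function_def
  by (auto simp: convex_power2 strict_mono_on_def power_strict_mono intro!: continuous_intros)
     real_asymp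

lemma young_function_abs: "young_function abs"
proof -
  have "convex_on UNIV (abs :: real \<Rightarrow> real)"
    using convex_on_dist[of UNIV "0::real"] by (simp add: dist_real_def)
  then show ?thesis
    unfolding young_function_def
    by (auto simp: strict_mono_on_def intro!: continuous_intros) real_asymp
qed

text \<open>For positive u the quotient is \<open>c / u\<close>. With this pair the Luxemburg norms
  are those of L1 and L2.\<close>

lemma abs_essentially_weaker_power2: "abs \<lless> power2"
  unfolding essentially_weaker_def by (intro allI impI) real_asymp

lemma luxemburg_norm_le:
  assumes "0 < k" "(\<integral>\<^sup>+\<omega>. ennreal (\<Phi> (\<bar>\<xi> \<omega>\<bar> / k)) \<partial>M) \<le> 1"
  shows "luxemburg_norm M \<Phi> \<xi> \<le> ennreal k"
  unfolding luxemburg_norm_def using assms by (intro INF_lower) simp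

lemma luxemburg_norm_zero:
  assumes "\<Phi> 0 = 0"
  shows "luxemburg_norm M \<Phi> (\<lambda>_. 0) = 0"
proof -
  \<comment> \<open>For the zero function every positive scale is admissible.\<close>
  have "luxemburg_norm M \<Phi> (\<lambda>_. 0) \<le> 0 + ennreal e" if "e > 0" for e
    using luxemburg_norm_le[OF that, of M \<Phi> "\<lambda>_. 0"] assms by simp
  then have "luxemburg_norm M \<Phi> (\<lambda>_. 0) \<le> 0"
    by (rule ennreal_le_epsilon)
  then show ?thesis by simp
qed

text \<open>An upper bound for the L2 norm of the piece at \<open>1 / real (Suc n)\<close>: the root
  of its squared height bound \<open>4 * (real n + 2)\<close> times the Lebesgue measure of its two
  support intervals. That measure has order n^(-3/2), so the bound decays like n^(-1/4).\<close>

definition norm_bound :: "nat \<Rightarrow> real" where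
  "norm_bound n = sqrt (4 * (real n + 2) * (1 / sqrt (real n + 1) - 1 / sqrt (real n + 2)))"

lemma norm_bound_pos: "0 < norm_bound n"
proof -
  have "sqrt (real n + 1) < sqrt (real n + 2)" by simp
  then have "1 / sqrt (real n + 2) < 1 / sqrt (real n + 1)" by (simp add: frac_less2)
  then show ?thesis unfolding norm_bound_def by simp
qed

lemma norm_bound_tendsto: "norm_bound \<longlonglongrightarrow> 0"
  unfolding norm_bound_def by real_asymp

section \<open>The process on a symmetric window\<close>

text \<open>Treats both total masses at once: S will be the interval of length 1 or the whole line.
  Symmetry gives centering; containing the interval keeps all pieces inside S.\<close>

locale symmetric_window =
  fixes S :: "real set"
  assumes S_borel [measurable]: "S \<in> sets borel"
    and S_sym: "- \<omega> \<in> S \<longleftrightarrow> \<omega> \<in> S"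
    and S_window: "{-1/2..1/2} \<subseteq> S"
begin

abbreviation "M \<equiv> restrict_space lborel S"

lemma measurable_pieces: "pieces t \<in> borel_measurable M"
  by (intro measurable_restrict_space1) simp

lemma probabilistic_space: "probabilistic_space M"
proof -
  \<comment> \<open>A singleton witnesses non-triviality, since 1/4 also lies in S.\<close>
  have "{0} \<in> sets M" "{0} \<noteq> space M"
    using S_window by (auto simp: sets_restrict_space_iff space_restrict_space subset_iff
        set_eq_iff intro!: exI[of _ "1/4::real"])
  moreover have "emeasure M (space M) \<noteq> 0"
  proof -
    have "emeasure lborel {-1/2..1/2::real} \<le> emeasure lborel S"
      using S_window by (intro emeasure_mono) auto
    then show ?thesis
      by (auto simp: emeasure_restrict_space space_restrict_space)
  qed
  ultimately show ?thesis unfolding probabilistic_space_def by blast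
qed

text \<open>Each piece is bounded with support in a fixed bounded interval, hence integrable even
  over the whole line. It is odd and S is symmetric, so the substitution of
  \<open>- \<omega>\<close> shows that the integral equals its own negative.\<close>

lemma centered: "centered M harmonic_points pieces"
  unfolding centered_def
proof
  fix t assume t: "t \<in> harmonic_points"
  obtain C where C: "\<bar>pieces t \<omega>\<bar> \<le> C" for \<omega>
  proof -
    from t consider "t = 0" | n where "t = 1 / real (Suc n)"
      unfolding harmonic_points_def by blast
    then have "\<exists>C. \<forall>\<omega>. \<bar>pieces t \<omega>\<bar> \<le> C"
    proof cases
      case 1
      then have "\<forall>\<omega>. \<bar>pieces t \<omega>\<bar> \<le> 0" by simp
      then show ?thesis by blast
    next
      case 2
      then show ?thesis using abs_pieces_le_sqrt by blast
    qed
    then show ?thesis using that by blast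
  qed
  have "integrable lborel (\<lambda>\<omega>. indicator S \<omega> *\<^sub>R pieces t \<omega>)"
  proof (rule Bochner_Integration.integrable_bound)
    show "integrable lborel (\<lambda>\<omega>::real. C * indicator {-1/2..1/2} \<omega>)" by simp
    have "norm (indicator S \<omega> *\<^sub>R pieces t \<omega>) \<le> norm (C * indicator {-1/2..1/2} \<omega>)" for \<omega>
      using C[of \<omega>] pieces_outside[OF t, of \<omega>]
      by (cases "\<omega> \<in> {-1/2..1/2}"; cases "\<omega> \<in> S")
        (simp_all del: atLeastAtMost_iff)
    then show "AE \<omega> in lborel. norm (indicator S \<omega> *\<^sub>R pieces t \<omega>)
        \<le> norm (C * indicator {-1/2..1/2} \<omega>)"
      by (intro always_eventually allI)
  qed measurable
  then have "integrable M (pieces t)"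
    by (subst integrable_restrict_space) auto
  moreover have "(LINT \<omega>|M. pieces t \<omega>) = 0"
  proof -
    have "(LINT \<omega>|lborel. indicator S \<omega> *\<^sub>R pieces t \<omega>)
        = (LINT \<omega>|lborel. indicator S (- \<omega>) *\<^sub>R pieces t (- \<omega>))"
      by (subst lborel_integral_real_affine[where c = "-1" and t = 0]) auto
    also have "\<dots> = - (LINT \<omega>|lborel. indicator S \<omega> *\<^sub>R pieces t \<omega>)"
      by (simp add: indicator_def S_sym flip: Bochner_Integration.integral_minus)
    finally show ?thesis
      by (simp add: integral_restrict_space)
  qed
  ultimately show "integrable M (pieces t) \<and> (LINT \<omega>|M. pieces t \<omega>) = 0" by blast
qed

text \<open>After scaling by \<open>norm_bound n\<close>, squared height times measure of the
  support is exactly 1, so this scale is admissible.\<close>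

lemma luxemburg_norm_pieces:
  "luxemburg_norm M power2 (pieces (1 / real (Suc n))) \<le> ennreal (norm_bound n)"
proof (rule luxemburg_norm_le[OF norm_bound_pos])
  let ?k = "norm_bound n" and ?a = "1 / (2 * sqrt (real n + 2))" and ?b = "1 / (2 * sqrt (real n + 1))"
  let ?C = "4 * (real n + 2) / ?k\<^sup>2"
  have ab: "?a \<le> ?b" by (simp add: frac_le)
  have "0 < ?a" by simp
  \<comment> \<open>Rewrites the squared scale with the total length of the two support intervals,
    so that it cancels in \<open>?C * (2 * (?b - ?a))\<close>.\<close>
  have k: "?k\<^sup>2 = 4 * (real n + 2) * (2 * (?b - ?a))"
    unfolding norm_bound_def using ab by (subst real_sqrt_pow2) auto
  have "?k\<^sup>2 > 0" using norm_bound_pos[of n] by simp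
  have "(\<integral>\<^sup>+\<omega>. ennreal ((\<bar>pieces (1 / real (Suc n)) \<omega>\<bar> / ?k)\<^sup>2) \<partial>M)
      = (\<integral>\<^sup>+\<omega>. ennreal ((\<bar>pieces (1 / real (Suc n)) \<omega>\<bar> / ?k)\<^sup>2) * indicator S \<omega> \<partial>lborel)"
    by (simp add: nn_integral_restrict_space)
  also have "\<dots> \<le> (\<integral>\<^sup>+\<omega>. ennreal ?C * indicator ({-?b..-?a} \<union> {?a..?b}) \<omega> \<partial>lborel)"
  proof (rule nn_integral_mono)
    fix \<omega> :: real
    have "(pieces (1 / real (Suc n)) \<omega>)\<^sup>2 \<le> (2 * sqrt (real n + 2))\<^sup>2"
      using power_mono[OF abs_pieces_le_sqrt abs_ge_zero, of n \<omega> 2] by (simp only: power2_abs)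
    then have "(\<bar>pieces (1 / real (Suc n)) \<omega>\<bar> / ?k)\<^sup>2 \<le> ?C"
      by (simp add: power_divide divide_right_mono)
    moreover have "\<omega> \<in> {-?b..-?a} \<union> {?a..?b}" if "pieces (1 / real (Suc n)) \<omega> \<noteq> 0"
      using pieces_support[OF that] by (auto simp: abs_if split: if_splits)
    ultimately show "ennreal ((\<bar>pieces (1 / real (Suc n)) \<omega>\<bar> / ?k)\<^sup>2) * indicator S \<omega>
        \<le> ennreal ?C * indicator ({-?b..-?a} \<union> {?a..?b}) \<omega>"
      by (cases "pieces (1 / real (Suc n)) \<omega> = 0")
        (auto simp: ennreal_leI split: split_indicator)
  qed
  also have "\<dots> = ennreal ?C * emeasure lborel ({-?b..-?a} \<union> {?a..?b})"
    by (rule nn_integral_cmult_indicator) simp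
  also have "emeasure lborel ({-?b..-?a} \<union> {?a..?b}) = ennreal (2 * (?b - ?a))"
  proof -
    have "emeasure lborel ({-?b..-?a} \<union> {?a..?b})
        = emeasure lborel {-?b..-?a} + emeasure lborel {?a..?b}"
      \<comment> \<open>Positivity of \<open>?a\<close> keeps the two intervals disjoint.\<close>
      by (rule plus_emeasure[symmetric]) (use \<open>0 < ?a\<close> in auto)
    then show ?thesis using ab by (simp flip: ennreal_plus)
  qed
  also have "ennreal ?C * ennreal (2 * (?b - ?a)) = ennreal (?C * (2 * (?b - ?a)))"
    by (rule ennreal_mult[symmetric]) (use ab in simp_all)
  also have "?C * (2 * (?b - ?a)) = 1"
    using k \<open>?k\<^sup>2 > 0\<close> by (metis (no_types, lifting) divide_self_if less_irrefl times_divide_eq_left)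
  finally show "(\<integral>\<^sup>+\<omega>. ennreal ((\<bar>pieces (1 / real (Suc n)) \<omega>\<bar> / ?k)\<^sup>2) \<partial>M) \<le> 1"
    by simp
qed

lemma luxemburg_norm_bounded: "(SUP t\<in>harmonic_points. luxemburg_norm M power2 (pieces t)) < \<infinity>"
proof -
  obtain B where B: "norm_bound n \<le> B" for n
    using convergent_imp_Bseq[OF convergentI[OF norm_bound_tendsto]]
    unfolding Bseq_def by (metis abs_ge_self order_trans real_norm_def)
  have "(SUP t\<in>harmonic_points. luxemburg_norm M power2 (pieces t)) \<le> ennreal B"
  proof (rule SUP_least)
    fix t assume "t \<in> harmonic_points"
    then consider "t = 0" | n where "t = 1 / real (Suc n)"
      unfolding harmonic_points_def by blast
    then show "luxemburg_norm M power2 (pieces t) \<le> ennreal B"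
    proof cases
      case 1
      then show ?thesis
        by (simp add: luxemburg_norm_zero)
    next
      case 2
      then show ?thesis
        using luxemburg_norm_pieces B ennreal_leI order_trans by blast
    qed
  qed
  then show ?thesis
    by (simp add: order.strict_trans1)
qed

text \<open>Only the limit point 0 needs an argument: the process vanishes there, and the norms of
  the pieces are squeezed between 0 and \<open>norm_bound\<close>.\<close>

lemma orlicz_continuous: "orlicz_continuous M power2 harmonic_points dist pieces"
  unfolding orlicz_continuous_def
proof
  fix t assume t: "t \<in> harmonic_points"
  have "((\<lambda>s. luxemburg_norm M power2 (\<lambda>\<omega>. pieces s \<omega> - pieces t \<omega>)) \<longlongrightarrow> 0)
      (at t within harmonic_points)"
  proof (rule tendsto_within_harmonic_points[OF t])
    assume "t = 0"
    have "(\<lambda>n. ennreal (norm_bound n)) \<longlonglongrightarrow> 0"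
      using tendsto_ennrealI[OF norm_bound_tendsto] by simp
    from tendsto_const this
    have "(\<lambda>n. luxemburg_norm M power2 (pieces (1 / real (Suc n)))) \<longlonglongrightarrow> 0"
      by (rule tendsto_sandwich[rotated 2])
        (intro always_eventually allI luxemburg_norm_pieces zero_le)+
    then show "(\<lambda>n. luxemburg_norm M power2 (\<lambda>\<omega>. pieces (1 / real (Suc n)) \<omega> - pieces t \<omega>))
        \<longlonglongrightarrow> 0"
      using \<open>t = 0\<close> by simp
  qed
  then show "((\<lambda>s. luxemburg_norm M power2 (\<lambda>\<omega>. pieces s \<omega> - pieces t \<omega>)) \<longlongrightarrow> 0)
      (atin (Metric_space.mtopology harmonic_points dist) t)"
    using t by (simp add: mtopology_dist atin_subtopology_within atin_within_euclidean)
qed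

text \<open>Dividing by k only rescales the divergent integral of \<open>1 / \<omega>\<close>, so no
  scale is admissible and the infimum runs over the empty set. In the integrand the outer absolute
  value is the Young function, the inner one comes from the norm.\<close>

lemma luxemburg_norm_sup_abs: "luxemburg_norm M abs (sup_abs harmonic_points pieces) = \<infinity>"
proof -
  have "\<not> (\<integral>\<^sup>+\<omega>. ennreal \<bar>\<bar>sup_abs harmonic_points pieces \<omega>\<bar> / k\<bar> \<partial>M) \<le> 1" if "k > 0" for k
  proof -
    have "\<infinity> = ennreal (1 / k) * (\<integral>\<^sup>+\<omega>. ennreal (1 / \<omega>) * indicator {0<..1/2} \<omega> \<partial>lborel)"
      using that by (simp add: nn_integral_inverse_at_0 ennreal_mult_eq_top_iff)
    also have "\<dots> = (\<integral>\<^sup>+\<omega>. ennreal (1 / k) * (ennreal (1 / \<omega>) * indicator {0<..1/2} \<omega>) \<partial>lborel)"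
      by (rule nn_integral_cmult[symmetric]) measurable
    also have "\<dots> \<le> (\<integral>\<^sup>+\<omega>. ennreal \<bar>\<bar>sup_abs harmonic_points pieces \<omega>\<bar> / k\<bar> * indicator S \<omega> \<partial>lborel)"
    proof (rule nn_integral_mono)
      fix \<omega> :: real
      have "ennreal (1 / k) * ennreal (1 / \<omega>) \<le> ennreal \<bar>\<bar>sup_abs harmonic_points pieces \<omega>\<bar> / k\<bar>"
        if \<omega>: "\<omega> \<in> {0<..1/2}"
      proof -
        have "1 / k * (1 / \<omega>) \<le> \<bar>\<bar>sup_abs harmonic_points pieces \<omega>\<bar> / k\<bar>"
          using sup_abs_pieces_ge[OF \<omega>] \<open>k > 0\<close> by (simp add: field_simps)
        then show ?thesis
          using \<open>k > 0\<close> \<omega> by (simp add: ennreal_leI flip: ennreal_mult)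
      qed
      moreover have "{0<..1/2} \<subseteq> S" using S_window by (auto simp: subset_iff)
      ultimately show "ennreal (1 / k) * (ennreal (1 / \<omega>) * indicator {0<..1/2} \<omega>)
          \<le> ennreal \<bar>\<bar>sup_abs harmonic_points pieces \<omega>\<bar> / k\<bar> * indicator S \<omega>"
        by (auto split: split_indicator)
    qed
    also have "\<dots> = (\<integral>\<^sup>+\<omega>. ennreal \<bar>\<bar>sup_abs harmonic_points pieces \<omega>\<bar> / k\<bar> \<partial>M)"
      by (simp add: nn_integral_restrict_space)
    finally have "\<infinity> \<le> (\<integral>\<^sup>+\<omega>. ennreal \<bar>\<bar>sup_abs harmonic_points pieces \<omega>\<bar> / k\<bar> \<partial>M)" .
    moreover have "\<not> (\<infinity> :: ennreal) \<le> 1" by (simp add: not_le)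
    ultimately show ?thesis
      using order_trans by blast
  qed
  then have "{k. 0 < k \<and> (\<integral>\<^sup>+\<omega>. ennreal \<bar>\<bar>sup_abs harmonic_points pieces \<omega>\<bar> / k\<bar> \<partial>M) \<le> 1} = {}"
    by blast
  then show ?thesis
    unfolding luxemburg_norm_def by (simp only: image_empty Inf_empty infinity_ennreal_def)
qed

lemma random_process: "random_process M harmonic_points pieces"
  unfolding random_process_def using measurable_pieces by blast

lemma continuous_paths: "continuous_paths M harmonic_points dist pieces"
  unfolding continuous_paths_def mtopology_dist
  using continuous_on_pieces by simp

lemma bounded_paths: "bounded_paths M harmonic_points pieces"
  unfolding bounded_paths_def using bdd_above_pieces by simp

text \<open>The parameter set is countable, so it serves as its own separant and every value already
  lies in the image.\<close>

lemma separable_process: "separable_process M harmonic_points dist pieces"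
proof -
  have "countable harmonic_points" by (simp add: harmonic_points_def)
  moreover have "pieces t \<omega> \<in> closure ((\<lambda>s. pieces s \<omega>) ` (harmonic_points \<inter> G))"
    if "openin (Metric_space.mtopology harmonic_points dist) G" "t \<in> G" for G t \<omega>
  proof -
    have "t \<in> harmonic_points \<inter> G"
      using that openin_subset by (fastforce simp: mtopology_dist)
    then show ?thesis by (intro subsetD[OF closure_subset]) blast
  qed
  ultimately show ?thesis
    unfolding separable_process_def by (intro exI[of _ harmonic_points]) auto
qed

end

section \<open>The two instances and the refutation\<close>

lemma compact_metric_space_harmonic_points: "compact_metric_space harmonic_points dist"
  unfolding compact_metric_space_def mtopology_dist
  by (simp add: Metric_space_dist compact_harmonic_points compact_space_subtopology)

lemma nontrivial_distance_harmonic_points: "nontrivial_distance harmonic_points dist"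
proof -
  \<comment> \<open>The point 1/2 has distance 1/2 from 0, which is neither 0 nor 1.\<close>
  have "1 / real (Suc 1) \<in> harmonic_points" unfolding harmonic_points_def by blast
  moreover have "0 \<in> harmonic_points" by (simp add: harmonic_points_def)
  moreover have "dist 0 (1 / real (Suc 1)) \<noteq> (if 0 = 1 / real (Suc 1) then 0 else 1)"
    by simp
  ultimately show ?thesis unfolding nontrivial_distance_def by blast
qed

interpretation unit_interval: symmetric_window "{-1/2..1/2}"
  by unfold_locales auto

interpretation whole_line: symmetric_window UNIV
  by unfold_locales auto

theorem mainTheorem1:
  "\<not> hypothesis_H_bounded TYPE(real) TYPE(real) \<and>
   \<not> hypothesis_H_continuous TYPE(real) TYPE(real) \<and>
   (\<forall>m\<in>{1, \<infinity>::ennreal}.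
      \<exists>(M::real measure) (T::real set) (d::real \<Rightarrow> real \<Rightarrow> real) (\<theta>::real \<Rightarrow> real \<Rightarrow> real) \<Phi> \<Psi>.
        probabilistic_space M \<and> emeasure M (space M) = m \<and>
        compact_metric_space T d \<and> nontrivial_distance T d \<and>
        random_process M T \<theta> \<and> young_function \<Phi> \<and> young_function \<Psi> \<and>
        \<comment> \<open>(A)\<close>
        centered M T \<theta> \<and> orlicz_continuous M \<Phi> T d \<theta> \<and> continuous_paths M T d \<theta> \<and>
        (SUP t\<in>T. luxemburg_norm M \<Phi> (\<theta> t)) < \<infinity> \<and>
        \<comment> \<open>(B)\<close>
        filterlim \<Psi> at_top at_top \<and> \<Psi> \<lless> \<Phi> \<and>
        \<comment> \<open>(C)\<close>
        luxemburg_norm M \<Psi> (sup_abs T \<theta>) = \<infinity>)"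
proof (intro conjI ballI)
  have [simp]: "harmonic_points \<noteq> {}" by (simp add: harmonic_points_def)
  have lim: "filterlim abs at_top (at_top :: real filter)"
    using young_function_abs by (simp add: young_function_def)
  note common = lim compact_metric_space_harmonic_points nontrivial_distance_harmonic_points
    young_function_power2 young_function_abs abs_essentially_weaker_power2
  note unit = unit_interval.probabilistic_space unit_interval.random_process
    unit_interval.centered unit_interval.orlicz_continuous unit_interval.continuous_paths
    unit_interval.luxemburg_norm_bounded unit_interval.luxemburg_norm_sup_abs
  note line = whole_line.probabilistic_space whole_line.random_process
    whole_line.centered whole_line.orlicz_continuous whole_line.continuous_paths
    whole_line.luxemburg_norm_bounded whole_line.luxemburg_norm_sup_abs
  show "\<not> hypothesis_H_bounded TYPE(real) TYPE(real)"
  proof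
    assume "hypothesis_H_bounded TYPE(real) TYPE(real)"
    \<comment> \<open>The instance of total mass 1 is used against both forms of the
      hypothesis.\<close>
    note H = this[unfolded hypothesis_H_bounded_def, rule_format,
        of unit_interval.M harmonic_points dist pieces power2 abs]
    have "luxemburg_norm unit_interval.M abs (sup_abs harmonic_points pieces) < \<infinity>"
      by (intro H conjI unit common Metric_space_dist unit_interval.separable_process
          unit_interval.bounded_paths \<open>harmonic_points \<noteq> {}\<close>)
    then show False by (simp only: unit less_irrefl)
  qed
  show "\<not> hypothesis_H_continuous TYPE(real) TYPE(real)"
  proof
    assume "hypothesis_H_continuous TYPE(real) TYPE(real)"
    note H = this[unfolded hypothesis_H_continuous_def, rule_format,
        of unit_interval.M harmonic_points dist pieces power2 abs]
    have "luxemburg_norm unit_interval.M abs (sup_abs harmonic_points pieces) < \<infinity>"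
      by (intro H conjI unit common unit_interval.separable_process \<open>harmonic_points \<noteq> {}\<close>)
    then show False by (simp only: unit less_irrefl)
  qed
  fix m :: ennreal assume "m \<in> {1, \<infinity>}"
  then consider "m = 1" | "m = \<infinity>" by blast
  then show "\<exists>(M::real measure) (T::real set) (d::real \<Rightarrow> real \<Rightarrow> real) (\<theta>::real \<Rightarrow> real \<Rightarrow> real) \<Phi> \<Psi>.
        probabilistic_space M \<and> emeasure M (space M) = m \<and>
        compact_metric_space T d \<and> nontrivial_distance T d \<and>
        random_process M T \<theta> \<and> young_function \<Phi> \<and> young_function \<Psi> \<and>
        centered M T \<theta> \<and> orlicz_continuous M \<Phi> T d \<theta> \<and> continuous_paths M T d \<theta> \<and>
        (SUP t\<in>T. luxemburg_norm M \<Phi> (\<theta> t)) < \<infinity> \<and>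
        filterlim \<Psi> at_top at_top \<and> \<Psi> \<lless> \<Phi> \<and>
        luxemburg_norm M \<Psi> (sup_abs T \<theta>) = \<infinity>"
  proof cases
    case 1
    have "emeasure unit_interval.M (space unit_interval.M) = m"
      by (simp add: 1 space_restrict_space emeasure_restrict_space)
    then show ?thesis
      \<comment> \<open>Resolution with the collected facts instantiates all six existential
        witnesses.\<close>
      by (intro exI conjI) (rule unit common | assumption)+
  next
    case 2
    have "emeasure whole_line.M (space whole_line.M) = m"
      by (simp add: 2 space_restrict_space emeasure_restrict_space)
    then show ?thesis
      by (intro exI conjI) (rule line common | assumption)+
  qed
qed

end
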